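(* If $G$ is a connected graph of order $n \ge 3$ and leaf order $\ell$, and $G$ is not a star, then for any integer $k \geq 1$, $$\iota_k(G)\le \frac{n-\ell}{2}.$$ Moreover, for any integers $k \geq 1$, $r \geq 1$ and $n \ge \max \{(k+2)r, 4\}$, there exists an $n$-vertex graph $G$ such that $\iota_k(G) = \frac{n-\ell}{2} = r$, where $\ell$ is the leaf order of $G$.
   Context: Graphs are finite and simple. A leaf is a vertex of degree $1$; the leaf order of $G$ is the number of leaves of $G$; the order is the number of vertices. A star is a graph isomorphic to $K_{1,m}$ for some $m \geq 1$. For $D\subseteq V(G)$, $N[D]$ is the set consisting of the vertices of $D$ and all their neighbours. For $k\ge 1$, a $k$-isolating set of $G$ is a set $D\subseteq V(G)$ (possibly empty) such that $G-N[D]$ contains no subgraph isomorphic to $K_{1,k}$ (equivalently, the maximum degree of $G-N[D]$ is at most $k-1$). The $k$-isolation number $\iota_k(G)$ is the size of a smallest $k$-isolating set of $G$. *)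

theory Defs
  imports Complex_Main "Graph_Theory.Graph_Theory"
begin

text \<open>
  A finite simple graph is the library's \<open>graph\<close>: a finite, symmetric, loop-free digraph
  without parallel arcs, in which an undirected edge is a pair of opposite arcs.
\<close>

text \<open>By symmetry, the out-degree of a vertex is its number of neighbours.\<close>
definition leaves :: "('a,'b) pre_digraph \<Rightarrow> 'a set" where
  "leaves G = {v \<in> verts G. out_degree G v = 1}"

definition leaf_order :: "('a,'b) pre_digraph \<Rightarrow> nat" where
  "leaf_order G = card (leaves G)"

definition star :: "('a,'b) pre_digraph \<Rightarrow> bool" where
  "star G \<longleftrightarrow> (\<exists>m\<ge>1. complete_bipartite_digraph 1 m G)"

definition closed_nbhd :: "('a,'b) pre_digraph \<Rightarrow> 'a set \<Rightarrow> 'a set" where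
  "closed_nbhd G D = D \<union> {v \<in> verts G. \<exists>u\<in>D. u \<rightarrow>\<^bsub>G\<^esub> v}"

definition isolating_set :: "nat \<Rightarrow> ('a,'b) pre_digraph \<Rightarrow> 'a set \<Rightarrow> bool" where
  "isolating_set k G D \<longleftrightarrow> D \<subseteq> verts G \<and>
     \<not> (\<exists>H. subgraph H (G \<restriction> (verts G - closed_nbhd G D)) \<and> complete_bipartite_digraph 1 k H)"

text \<open>The minimum is attained for every finite graph when \<open>k \<ge> 1\<close>, since \<open>verts G\<close> is isolating.\<close>
definition isolation_number :: "nat \<Rightarrow> ('a,'b) pre_digraph \<Rightarrow> nat" where
  "isolation_number k G = (LEAST m. \<exists>D. isolating_set k G D \<and> card D = m)"

end

theory Submission
  imports Defs
begin

text \<open>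
  The upper bound is Ore's domination theorem applied to the non-leaves. If \<open>G\<close> is connected
  with at least three vertices, then two leaves are never adjacent, so a set \<open>D\<close> that
  dominates all \<open>n - \<ell>\<close> non-leaves leaves behind an edgeless graph, which contains no
  \<open>K\<^bsub>1,k\<^esub>\<close> with \<open>k \<ge> 1\<close>. A non-leaf all of whose neighbours are leaves
  would be the centre of a star that is all of \<open>G\<close>; hence, when \<open>G\<close> is not a star, the
  non-leaves induce a graph without isolated vertices, and Ore's theorem provides such a \<open>D\<close>
  containing at most half of them (\<open>ore_domination\<close>, \<open>isolation_number_upper\<close>).

  For sharpness, take \<open>r\<close> centres \<open>x\<^sub>i\<close>, give each at least \<open>k\<close> pendant leaves and
  one further neighbour \<open>y\<^sub>i\<close>, and make the \<open>y\<^sub>i\<close> a clique. The \<open>2 * r\<close> vertices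
  \<open>x\<^sub>i, y\<^sub>i\<close> are the non-leaves. The centres form an isolating set, and the stars at the
  \<open>x\<^sub>i\<close> have pairwise disjoint closed neighbourhoods, each of which an isolating set has
  to meet (\<open>isolation_number_ge_packing\<close>). If \<open>r = 1\<close>, the single \<open>y\<close> would be a leaf, so one
  pendant vertex is moved to it; the star at \<open>x\<close> then uses \<open>y\<close> as one of its \<open>k\<close> tips.
\<close>

section \<open>Stars and isolating sets in terms of adjacency\<close>

lemma (in graph) adj_sym: "u \<rightarrow>\<^bsub>G\<^esub> v \<Longrightarrow> v \<rightarrow>\<^bsub>G\<^esub> u"
  by (rule graph_symmetric)

lemma (in graph) leaves_conv: "v \<in> leaves G \<longleftrightarrow> v \<in> verts G \<and> (\<exists>!w. v \<rightarrow>\<^bsub>G\<^esub> w)"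
proof -
  have inj: "inj_on (head G) (out_arcs G v)"
    by (auto intro!: inj_onI no_multi_arcs simp: arc_to_ends_def)
  have "head G ` out_arcs G v = {w. v \<rightarrow>\<^bsub>G\<^esub> w}"
    by (auto simp: arcs_ends_def arc_to_ends_def intro: rev_image_eqI)
  with card_image[OF inj] have "out_degree G v = card {w. v \<rightarrow>\<^bsub>G\<^esub> w}"
    by (simp add: out_degree_def)
  moreover have "card {w. P w} = 1 \<longleftrightarrow> (\<exists>!w. P w)" for P :: "'a \<Rightarrow> bool"
    by (simp add: card_1_singleton_iff set_eq_iff) metis
  ultimately show ?thesis by (simp add: leaves_def)
qed

text \<open>
  For the converse direction the star has to be produced as a graph: its arcs are the arcs of
  \<open>G\<close> that join the centre with a tip, in either direction.
\<close>
lemma (in graph) star_in_induced_iff: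
  assumes W: "W \<subseteq> verts G"
  shows "(\<exists>H. subgraph H (G \<restriction> W) \<and> complete_bipartite_digraph 1 k H) \<longleftrightarrow>
         (\<exists>c\<in>W. \<exists>S\<subseteq>W. card S = k \<and> (\<forall>v\<in>S. c \<rightarrow>\<^bsub>G\<^esub> v))"
proof
  assume "\<exists>H. subgraph H (G \<restriction> W) \<and> complete_bipartite_digraph 1 k H"
  then obtain H U S where H: "subgraph H (G \<restriction> W)" "verts H = U \<union> S" "card U = 1" "card S = k"
      "arcs_ends H = U \<times> S \<union> S \<times> U"
    unfolding complete_bipartite_digraph_def by blast
  from \<open>card U = 1\<close> obtain c where c: "U = {c}" by (auto simp: card_1_singleton_iff)
  have "verts H \<subseteq> W" using subgraph_imp_subverts[OF H(1)] by simp
  moreover have "arcs_ends H \<subseteq> arcs_ends G"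
    using arcs_ends_mono[OF H(1)] by (auto simp: arcs_ends_def arc_to_ends_def)
  ultimately show "\<exists>c\<in>W. \<exists>S\<subseteq>W. card S = k \<and> (\<forall>v\<in>S. c \<rightarrow>\<^bsub>G\<^esub> v)"
    using H c by (intro bexI[of _ c] exI[of _ S]) auto
next
  assume "\<exists>c\<in>W. \<exists>S\<subseteq>W. card S = k \<and> (\<forall>v\<in>S. c \<rightarrow>\<^bsub>G\<^esub> v)"
  then obtain c S where c: "c \<in> W" and S: "S \<subseteq> W" "card S = k" "\<And>v. v \<in> S \<Longrightarrow> c \<rightarrow>\<^bsub>G\<^esub> v"
    by blast
  define H where "H = \<lparr>verts = insert c S,
    arcs = {e \<in> arcs G. tail G e = c \<and> head G e \<in> S \<or> tail G e \<in> S \<and> head G e = c},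
    tail = tail G, head = head G\<rparr>"
  have cS: "c \<notin> S" using S(3) adj_not_same by blast
  have finS: "finite S" using S(1) W by (meson finite_subset finite_verts)
  have ends: "arcs_ends H = {c} \<times> S \<union> S \<times> {c}"
  proof -
    have "(c, v) \<in> arcs_ends H" "(v, c) \<in> arcs_ends H" if v: "v \<in> S" for v
    proof -
      obtain e where "e \<in> arcs G" "tail G e = c" "head G e = v"
        using S(3)[OF v] by (rule reachableE)
      then show "(c, v) \<in> arcs_ends H"
        using v by (auto simp: H_def arcs_ends_def arc_to_ends_def intro!: rev_image_eqI[of e])
      obtain e where "e \<in> arcs G" "tail G e = v" "head G e = c"
        using adj_sym[OF S(3)[OF v]] by (rule reachableE)
      then show "(v, c) \<in> arcs_ends H"
        using v by (auto simp: H_def arcs_ends_def arc_to_ends_def intro!: rev_image_eqI[of e])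
    qed
    then show ?thesis by (auto simp: H_def arcs_ends_def arc_to_ends_def)
  qed
  have graphH: "graph H"
  proof
    show "symmetric H" unfolding symmetric_def ends by (auto intro!: symI)
    show "e1 = e2" if "e1 \<in> arcs H" "e2 \<in> arcs H" "arc_to_ends H e1 = arc_to_ends H e2" for e1 e2
      using that no_multi_arcs[of e1 e2] by (auto simp: H_def arc_to_ends_def)
  qed (use finS cS in \<open>auto simp: H_def\<close>)
  then interpret H: graph H .
  have "wf_digraph (G \<restriction> W)" by (rule wellformed_induce_subgraph)
  then have "subgraph H (G \<restriction> W)"
    using c S(1) H.wf_digraph by (auto simp: subgraph_def compatible_def H_def)
  moreover have "verts H = {c} \<union> S" by (simp add: H_def)
  then have "complete_bipartite_digraph 1 k H"
    unfolding complete_bipartite_digraph_def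
    by (intro conjI graphH exI[of _ "{c}"] exI[of _ S]) (use ends cS S(2) in simp_all)
  ultimately show "\<exists>H. subgraph H (G \<restriction> W) \<and> complete_bipartite_digraph 1 k H" by blast
qed

lemma (in graph) isolating_set_iff:
  "isolating_set k G D \<longleftrightarrow> D \<subseteq> verts G \<and>
     \<not> (\<exists>c \<in> verts G - closed_nbhd G D. \<exists>S \<subseteq> verts G - closed_nbhd G D.
          card S = k \<and> (\<forall>v\<in>S. c \<rightarrow>\<^bsub>G\<^esub> v))"
  unfolding isolating_set_def by (subst star_in_induced_iff) auto

lemma (in graph) isolating_set_if_independent:
  assumes "k \<ge> 1" "D \<subseteq> verts G"
    and indep: "\<And>u v. u \<in> verts G - closed_nbhd G D \<Longrightarrow> v \<in> verts G - closed_nbhd G D \<Longrightarrow>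
      \<not> u \<rightarrow>\<^bsub>G\<^esub> v"
  shows "isolating_set k G D"
proof -
  have "S \<noteq> {}" if "card S = k" for S :: "'a set" using that \<open>k \<ge> 1\<close> by auto
  with assms(2) indep show ?thesis unfolding isolating_set_iff by blast
qed

lemma isolation_number_le: "isolating_set k G D \<Longrightarrow> isolation_number k G \<le> card D"
  unfolding isolation_number_def by (rule Least_le) blast

text \<open>
  Each star survives unless the isolating set meets its closed neighbourhood; this is where
  the symmetry of adjacency enters.
\<close>
lemma (in graph) isolation_number_ge_packing:
  assumes "k \<ge> 1"
    and c: "\<And>i. i \<in> I \<Longrightarrow> c i \<in> verts G"
    and S: "\<And>i. i \<in> I \<Longrightarrow> card (S i) = k" "\<And>i v. i \<in> I \<Longrightarrow> v \<in> S i \<Longrightarrow> c i \<rightarrow>\<^bsub>G\<^esub> v"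
    and disj: "\<And>i j. i \<in> I \<Longrightarrow> j \<in> I \<Longrightarrow> i \<noteq> j \<Longrightarrow>
      closed_nbhd G (insert (c i) (S i)) \<inter> closed_nbhd G (insert (c j) (S j)) = {}"
  shows "card I \<le> isolation_number k G"
proof -
  have "isolating_set k G (verts G)"
    using \<open>k \<ge> 1\<close> by (rule isolating_set_if_independent) (auto simp: closed_nbhd_def)
  then obtain D where D: "isolating_set k G D" "card D = isolation_number k G"
    unfolding isolation_number_def
    using LeastI_ex[of "\<lambda>m. \<exists>D. isolating_set k G D \<and> card D = m"] by blast
  have DV: "D \<subseteq> verts G" using D(1) by (simp add: isolating_set_def)
  have meets: "\<exists>d. d \<in> D \<and> d \<in> closed_nbhd G (insert (c i) (S i))" if i: "i \<in> I" for i
  proof (rule ccontr)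
    assume "\<not> ?thesis"
    then have "insert (c i) (S i) \<inter> closed_nbhd G D = {}"
      using DV by (auto simp: closed_nbhd_def dest: adj_sym)
    moreover have "S i \<subseteq> verts G" using S(2)[OF i] adj_in_verts by blast
    ultimately have "c i \<in> verts G - closed_nbhd G D" "S i \<subseteq> verts G - closed_nbhd G D"
      using c[OF i] by auto
    moreover have "\<forall>v\<in>S i. c i \<rightarrow>\<^bsub>G\<^esub> v" using S(2)[OF i] by blast
    ultimately have "\<exists>c \<in> verts G - closed_nbhd G D. \<exists>S \<subseteq> verts G - closed_nbhd G D.
        card S = k \<and> (\<forall>v\<in>S. c \<rightarrow>\<^bsub>G\<^esub> v)"
      using S(1)[OF i] by (intro bexI[of _ "c i"] exI[of _ "S i"] conjI)
    then show False using D(1) by (simp add: isolating_set_iff)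
  qed
  define p where "p i = (SOME d. d \<in> D \<and> d \<in> closed_nbhd G (insert (c i) (S i)))" for i
  have p: "p i \<in> D" "p i \<in> closed_nbhd G (insert (c i) (S i))" if "i \<in> I" for i
    using someI_ex[OF meets[OF that]] by (auto simp: p_def)
  have "inj_on p I"
  proof (intro inj_onI, rule ccontr)
    fix i j assume ij: "i \<in> I" "j \<in> I" "p i = p j" "i \<noteq> j"
    then show False using disj[OF ij(1,2,4)] p(2)[of i] p(2)[of j] by auto
  qed
  moreover have "p ` I \<subseteq> D" using p(1) by auto
  moreover have "finite D" using DV by (meson finite_subset finite_verts)
  ultimately have "card I \<le> card D" by (rule card_inj_on_le)
  then show ?thesis by (simp add: D(2))
qed

section \<open>The upper bound\<close>

text \<open>
  Ore's theorem. In a dominating set \<open>D\<close> of minimum size, a vertex without a neighbour outside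
  \<open>D\<close> would have one inside \<open>D\<close> and be redundant; so the complement of \<open>D\<close> dominates as
  well, hence is at least as large as \<open>D\<close>.
\<close>
lemma ore_domination:
  assumes "finite V" and sym: "\<And>u v. E u v \<Longrightarrow> E v u"
    and nbr: "\<And>v. v \<in> V \<Longrightarrow> \<exists>u\<in>V. u \<noteq> v \<and> E v u"
  shows "\<exists>D\<subseteq>V. 2 * card D \<le> card V \<and> (\<forall>v\<in>V - D. \<exists>u\<in>D. E u v)"
proof -
  define dom where "dom D \<longleftrightarrow> D \<subseteq> V \<and> (\<forall>v\<in>V - D. \<exists>u\<in>D. E u v)" for D
  have "dom V" by (simp add: dom_def)
  then obtain D where D: "dom D" and min: "\<And>D'. dom D' \<Longrightarrow> card D \<le> card D'"
    using ex_has_least_nat[of dom V card] by blast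
  have DV: "D \<subseteq> V" using D by (simp add: dom_def)
  then have finD: "finite D" using \<open>finite V\<close> finite_subset by blast
  have "dom (V - D)"
  proof (rule ccontr)
    assume "\<not> dom (V - D)"
    then obtain v where v: "v \<in> D" "\<And>u. u \<in> V - D \<Longrightarrow> \<not> E u v"
      using DV by (auto simp: dom_def)
    obtain u where u: "u \<in> D" "u \<noteq> v" "E u v"
      using nbr[of v] v DV sym by blast
    have "dom (D - {v})"
      using D v u sym unfolding dom_def by (metis DiffE DiffI empty_iff insert_iff subset_iff)
    then have "card D \<le> card (D - {v})" by (rule min)
    then show False using v(1) finD card_Diff1_less[of D v] by simp
  qed
  then have "card D \<le> card (V - D)" by (rule min)
  moreover have "card (V - D) + card D = card V"
    using DV \<open>finite V\<close> finD by (simp add: card_Diff_subset card_mono)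
  ultimately show ?thesis using D unfolding dom_def by (intro exI[of _ D]) auto
qed

lemma (in graph) connected_closed_set:
  assumes "Digraph_Component.connected G" "v \<in> A" "v \<in> verts G"
    and closed: "\<And>x y. x \<in> A \<Longrightarrow> x \<rightarrow>\<^bsub>G\<^esub> y \<Longrightarrow> y \<in> A"
  shows "verts G \<subseteq> A"
proof
  fix w assume "w \<in> verts G"
  have "strongly_connected G"
    using assms(1) sym_arcs by (simp add: symmetric_connected_imp_strongly_connected)
  with \<open>w \<in> verts G\<close> assms(3) have "v \<rightarrow>\<^sup>*\<^bsub>G\<^esub> w" by blast
  then show "w \<in> A" by (induct rule: reachable_induct) (use assms in auto)
qed

lemma (in graph) leaves_not_adjacent:
  assumes "Digraph_Component.connected G" "card (verts G) \<ge> 3" "u \<in> leaves G" "v \<in> leaves G"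
  shows "\<not> u \<rightarrow>\<^bsub>G\<^esub> v"
proof
  assume uv: "u \<rightarrow>\<^bsub>G\<^esub> v"
  have "y \<in> {u, v}" if "x \<in> {u, v}" "x \<rightarrow>\<^bsub>G\<^esub> y" for x y
    using that assms(3,4) uv adj_sym[OF uv] unfolding leaves_conv by blast
  then have "verts G \<subseteq> {u, v}"
    using connected_closed_set[OF assms(1), of u "{u, v}"] adj_in_verts[OF uv] by blast
  then have "card (verts G) \<le> card {u, v}" by (rule card_mono[rotated]) simp
  also have "\<dots> \<le> 2" using card_insert_le_m1[of 2 "{v}" u] by simp
  finally show False using assms(2) by simp
qed

text \<open>
  A vertex with only leaves around it is, together with them, closed under adjacency, hence
  it is the centre of a star that exhausts a connected graph.
\<close>
lemma (in graph) non_leaf_has_non_leaf_nbr: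
  assumes conn: "Digraph_Component.connected G" and n: "card (verts G) \<ge> 2" and "\<not> star G"
    and v: "v \<in> verts G"
  shows "\<exists>u \<in> verts G - leaves G. v \<rightarrow>\<^bsub>G\<^esub> u"
proof (rule ccontr)
  assume "\<not> ?thesis"
  then have nb: "u \<in> leaves G" if "v \<rightarrow>\<^bsub>G\<^esub> u" for u
    using that adj_in_verts(2)[OF that] by (metis DiffI)
  define N where "N = {u. v \<rightarrow>\<^bsub>G\<^esub> u}"
  have only_v: "y = v" if "x \<in> N" "x \<rightarrow>\<^bsub>G\<^esub> y" for x y
  proof -
    have "v \<rightarrow>\<^bsub>G\<^esub> x" using that(1) by (simp add: N_def)
    then have "x \<rightarrow>\<^bsub>G\<^esub> v" "\<exists>!w. x \<rightarrow>\<^bsub>G\<^esub> w"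
      using adj_sym[of v x] nb[of x] by (simp_all add: leaves_conv)
    with that(2) show ?thesis by blast
  qed
  have vN: "v \<notin> N" using adj_not_same by (auto simp: N_def)
  have "verts G \<subseteq> insert v N"
  proof (rule connected_closed_set[OF conn, of v])
    show "y \<in> insert v N" if "x \<in> insert v N" "x \<rightarrow>\<^bsub>G\<^esub> y" for x y
    proof (cases "x = v")
      case True
      then show ?thesis using that(2) by (simp add: N_def)
    next
      case False
      then show ?thesis using that(1) only_v[OF _ that(2)] by simp
    qed
  qed (rule insertI1, rule v)
  moreover have "N \<subseteq> verts G" unfolding N_def by (blast intro: adj_in_verts(2))
  ultimately have V: "verts G = insert v N" using v by (intro equalityI) simp_all
  have finN: "finite N" using V finite_verts by (metis finite_insert)
  have "arcs_ends G = {v} \<times> N \<union> N \<times> {v}"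
  proof (intro equalityI subsetI)
    fix e assume e: "e \<in> arcs_ends G"
    obtain x y where xy: "e = (x, y)" by (cases e)
    then have "x \<in> insert v N" using e V adj_in_verts(1)[of x y] by simp
    then show "e \<in> {v} \<times> N \<union> N \<times> {v}"
    proof (cases "x = v")
      case True
      then show ?thesis using e xy by (simp add: N_def)
    next
      case False
      then have "x \<in> N" using \<open>x \<in> insert v N\<close> by simp
      then have "y = v" using only_v[of x y] e xy by simp
      with \<open>x \<in> N\<close> show ?thesis using xy by simp
    qed
  next
    fix e assume "e \<in> {v} \<times> N \<union> N \<times> {v}"
    then show "e \<in> arcs_ends G" using adj_sym by (auto simp: N_def)
  qed
  then have "complete_bipartite_digraph 1 (card N) G"
    unfolding complete_bipartite_digraph_def
    by (intro conjI graph_axioms exI[of _ "{v}"] exI[of _ N]) (use V vN in simp_all)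
  moreover have "card N \<ge> 1" using n V vN finN by simp
  ultimately show False using \<open>\<not> star G\<close> by (auto simp: star_def)
qed

lemma (in graph) isolation_number_upper:
  assumes conn: "Digraph_Component.connected G" and n: "card (verts G) \<ge> 3" and "\<not> star G"
    and "k \<ge> 1"
  shows "2 * isolation_number k G + leaf_order G \<le> card (verts G)"
proof -
  define V where "V = verts G - leaves G"
  have "leaves G \<subseteq> verts G" by (auto simp: leaves_def)
  then have cardV: "card V + leaf_order G = card (verts G)"
    by (simp add: V_def leaf_order_def card_Diff_subset finite_subset card_mono)
  have "\<exists>u\<in>V. u \<noteq> v \<and> v \<rightarrow>\<^bsub>G\<^esub> u" if "v \<in> V" for v
    using non_leaf_has_non_leaf_nbr[OF conn _ \<open>\<not> star G\<close>, of v] that n adj_not_same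
    unfolding V_def by fastforce
  then obtain D where D: "D \<subseteq> V" "2 * card D \<le> card V" "\<And>v. v \<in> V - D \<Longrightarrow> \<exists>u\<in>D. u \<rightarrow>\<^bsub>G\<^esub> v"
    using ore_domination[of V "\<lambda>u v. u \<rightarrow>\<^bsub>G\<^esub> v"] adj_sym by (auto simp: V_def)
  have "verts G - closed_nbhd G D \<subseteq> leaves G"
    using D(3) by (auto simp: V_def closed_nbhd_def)
  then have "\<not> u \<rightarrow>\<^bsub>G\<^esub> v" if "u \<in> verts G - closed_nbhd G D" "v \<in> verts G - closed_nbhd G D" for u v
    using that by (intro leaves_not_adjacent[OF conn n] subsetD[of _ "leaves G"])
  then have "isolating_set k G D"
    using D(1) by (intro isolating_set_if_independent[OF \<open>k \<ge> 1\<close>]) (simp_all add: V_def subset_iff)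
  then have "isolation_number k G \<le> card D" by (rule isolation_number_le)
  with D(2) cardV show ?thesis by linarith
qed

section \<open>Graphs attaining the bound\<close>

text \<open>
  The centres are \<open>i < r\<close>, the clique consists of the vertices \<open>r + i\<close>, and the
  leaves are \<open>2 * r, \<dots>, n - 1\<close>. Attaching a leaf to its residue modulo \<open>r\<close> spreads the leaves
  evenly, and makes the \<open>i\<close>-th star with its closed neighbourhood a subset of a single
  residue class. For \<open>r = 1\<close> the last leaf goes to the clique vertex \<open>1\<close> instead.
\<close>
definition anchor :: "nat \<Rightarrow> nat \<Rightarrow> nat \<Rightarrow> nat" where
  "anchor r n v = (if r = 1 \<and> v = n - 1 then 1 else v mod r)"

definition half_edge :: "nat \<Rightarrow> nat \<Rightarrow> nat \<Rightarrow> nat \<Rightarrow> bool" where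
  "half_edge r n u v \<longleftrightarrow>
     (u < r \<and> v = r + u) \<or>
     (u \<in> {r..<2*r} \<and> v \<in> {r..<2*r} \<and> u \<noteq> v) \<or>
     (2*r \<le> v \<and> u = anchor r n v)"

definition leafy_clique :: "nat \<Rightarrow> nat \<Rightarrow> nat pair_pre_digraph" where
  "leafy_clique r n = \<lparr>pverts = {..<n},
     parcs = {(u, v). u < n \<and> v < n \<and> (half_edge r n u v \<or> half_edge r n v u)}\<rparr>"

lemma leafy_clique_simps:
  "pverts (leafy_clique r n) = {..<n}"
  "(u, v) \<in> parcs (leafy_clique r n) \<longleftrightarrow> u < n \<and> v < n \<and> (half_edge r n u v \<or> half_edge r n v u)"
  by (auto simp: leafy_clique_def)

lemma anchor_less:
  assumes "r \<ge> 1"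
  shows "anchor r n v < 2 * r"
proof -
  have "v mod r < r" using assms by simp
  then show ?thesis by (auto simp: anchor_def)
qed

lemma half_edge_irrefl: "r \<ge> 1 \<Longrightarrow> \<not> half_edge r n v v"
  using anchor_less[of r n v] by (auto simp: half_edge_def)

lemma graph_leafy_clique:
  assumes "r \<ge> 1"
  shows "graph (with_proj (leafy_clique r n))"
proof -
  have "parcs (leafy_clique r n) \<subseteq> {..<n} \<times> {..<n}" by (auto simp: leafy_clique_def)
  then have fin: "finite (parcs (leafy_clique r n))" by (rule finite_subset) simp
  have "pair_graph (leafy_clique r n)"
  proof
    show "symmetric (with_proj (leafy_clique r n))"
      by (auto simp: symmetric_def leafy_clique_simps intro!: symI)
    show "fst e \<noteq> snd e" if "e \<in> parcs (leafy_clique r n)" for e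
      using that half_edge_irrefl[OF assms] by (cases e) (auto simp: leafy_clique_simps)
  qed (use fin in \<open>auto simp: leafy_clique_def\<close>)
  then show ?thesis by (rule pair_graph.pair_graphD_graph)
qed

text \<open>
  The bound \<open>3 * r \<le> n\<close> makes \<open>2 * r + i\<close> a leaf at the centre \<open>i\<close>; for \<open>r = 1\<close> the bound
  \<open>4 \<le> n\<close> ensures that it is not the leaf moved to the clique vertex.
\<close>
lemma leaves_leafy_clique:
  assumes r: "r \<ge> 1" and n: "3 * r \<le> n" "4 \<le> n"
  shows "leaves (with_proj (leafy_clique r n)) = {2*r..<n}"
proof -
  interpret graph "with_proj (leafy_clique r n)" using r by (rule graph_leafy_clique)
  have nbr: "(u, v) \<in> parcs (leafy_clique r n) \<longleftrightarrow> v = anchor r n u" if "2*r \<le> u" "u < n" for u v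
    using that anchor_less[OF r, of n u] anchor_less[OF r, of n v] n
    by (auto simp: leafy_clique_simps half_edge_def)
  have two: "\<exists>v w. v \<noteq> w \<and> (u, v) \<in> parcs (leafy_clique r n) \<and> (u, w) \<in> parcs (leafy_clique r n)"
    if u: "u < 2*r" for u
  proof (cases "u < r")
    case True
    then have "anchor r n (2*r + u) = u" using n by (auto simp: anchor_def)
    then show ?thesis using True n
      by (intro exI[of _ "r + u"] exI[of _ "2*r + u"]) (auto simp: leafy_clique_simps half_edge_def)
  next
    case False
    define w where "w = (if r = 1 then n - 1 else if u = r then r + 1 else r)"
    have "u - r < r" "u = r + (u - r)" using u False by auto
    then have "(u, u - r) \<in> parcs (leafy_clique r n)"
      using u n by (auto simp: leafy_clique_simps half_edge_def)
    moreover have "(u, w) \<in> parcs (leafy_clique r n)"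
      using u False n r by (auto simp: leafy_clique_simps half_edge_def w_def anchor_def)
    moreover have "u - r \<noteq> w" using u False n by (auto simp: w_def)
    ultimately show ?thesis by blast
  qed
  show ?thesis
  proof (intro set_eqI iffI)
    fix v assume "v \<in> leaves (with_proj (leafy_clique r n))"
    then have "v < n" "\<exists>!w. (v, w) \<in> parcs (leafy_clique r n)"
      unfolding leaves_conv by (auto simp: leafy_clique_simps(1))
    then show "v \<in> {2*r..<n}" using two[of v] by (cases "v < 2*r") auto
  next
    fix v assume "v \<in> {2*r..<n}"
    then show "v \<in> leaves (with_proj (leafy_clique r n))"
      unfolding leaves_conv using nbr[of v] by (simp add: leafy_clique_simps(1))
  qed
qed

lemma isolation_number_leafy_clique:
  assumes k: "k \<ge> 1" and r: "r \<ge> 1" and n: "(k + 2) * r \<le> n" "4 \<le> n"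
  shows "isolation_number k (with_proj (leafy_clique r n)) = r"
proof (rule antisym)
  let ?G = "with_proj (leafy_clique r n)"
  interpret graph ?G using r by (rule graph_leafy_clique)
  have "3 * r \<le> (k + 2) * r" using k by (intro mult_right_mono) auto
  then have n3: "3 * r \<le> n" using n by linarith
  have "v < r \<or> (\<exists>u\<in>{..<r}. (u, v) \<in> parcs (leafy_clique r n))" if "v < 2 * r" for v
    using that n3 by (cases "v < r")
      (auto simp: leafy_clique_simps half_edge_def intro!: bexI[of _ "v - r"])
  then have outside: "verts ?G - closed_nbhd ?G {..<r} \<subseteq> {2*r..<n}"
    by (simp add: subset_iff closed_nbhd_def leafy_clique_simps(1) not_le) (meson not_le)
  have "isolating_set k ?G {..<r}"
  proof (rule isolating_set_if_independent[OF k])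
    show "{..<r} \<subseteq> verts ?G" using n3 by (auto simp: leafy_clique_simps(1))
    fix u v assume "u \<in> verts ?G - closed_nbhd ?G {..<r}" "v \<in> verts ?G - closed_nbhd ?G {..<r}"
    then have "2 * r \<le> u" "2 * r \<le> v" using outside by auto
    then show "\<not> u \<rightarrow>\<^bsub>?G\<^esub> v"
      using anchor_less[OF r, of n u] anchor_less[OF r, of n v]
      by (auto simp: leafy_clique_simps half_edge_def)
  qed
  then show "isolation_number k ?G \<le> r" using isolation_number_le by fastforce

  \<comment> \<open>The offset \<open>2\<close> makes all tips leaves. For \<open>r = 1\<close> there may be only \<open>k - 1\<close> leaves at the
    centre \<open>0\<close>, so the tips start with the clique vertex \<open>1\<close>.\<close>
  define a :: nat where "a = (if r = 1 then 1 else 2)"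
  define S where "S i = (\<lambda>t. i + r * (t + a)) ` {..<k}" for i
  have S_adj: "(i, v) \<in> parcs (leafy_clique r n)" if i: "i < r" and v: "v \<in> S i" for i v
  proof (cases "r = 1")
    case True
    then obtain t where "t < k" "v = t + 1" "i = 0" using i v by (auto simp: S_def a_def)
    then show ?thesis using True n
      by (cases "t = 0") (auto simp: leafy_clique_simps half_edge_def anchor_def)
  next
    case False
    then obtain t where t: "t < k" "v = i + r * (t + 2)" using v by (auto simp: S_def a_def)
    have "r * (t + 3) \<le> r * (k + 2)" using t by (intro mult_left_mono) auto
    then have "v < n" using t i n by (simp add: algebra_simps)
    moreover have "anchor r n v = i"
      using i False mod_mult_self2[of i r "t + 2"] unfolding t(2) anchor_def by simp
    ultimately show ?thesis using t i by (auto simp: leafy_clique_simps half_edge_def)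
  qed
  have residue: "closed_nbhd ?G (insert i (S i)) \<subseteq> {v. v mod r = i}" if i: "i < r" for i
  proof (cases "r = 1")
    case True
    then show ?thesis using i by simp
  next
    case False
    have S_leaf: "2 * r \<le> v \<and> v mod r = i" if "v \<in> S i" for v
    proof -
      obtain t where t: "v = i + r * (t + 2)" using \<open>v \<in> S i\<close> False by (auto simp: S_def a_def)
      then show ?thesis using i mod_mult_self2[of i r "t + 2"] by simp
    qed
    have "v mod r = i" if "u = i \<or> u \<in> S i" "(u, v) \<in> parcs (leafy_clique r n)" for u v
    proof (cases "u = i")
      case True
      then show ?thesis using that(2) i False
        by (auto simp: leafy_clique_simps half_edge_def anchor_def)
    next
      case u: False
      then have "2 * r \<le> u" "u mod r = i" using that(1) S_leaf by auto
      then show ?thesis using that(2) i False anchor_less[OF r, of n v]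
        by (auto simp: leafy_clique_simps half_edge_def anchor_def)
    qed
    then show ?thesis using S_leaf i by (auto simp: closed_nbhd_def)
  qed
  have "card {..<r} \<le> isolation_number k ?G"
  proof (rule isolation_number_ge_packing[where c = "\<lambda>i. i" and S = S])
    show "card (S i) = k" for i
      unfolding S_def using r by (subst card_image) (auto intro!: inj_onI)
    show "closed_nbhd ?G (insert i (S i)) \<inter> closed_nbhd ?G (insert j (S j)) = {}"
      if "i \<in> {..<r}" "j \<in> {..<r}" "i \<noteq> j" for i j
      using residue[of i] residue[of j] that by auto
  qed (use k n3 S_adj in \<open>auto simp: leafy_clique_simps(1)\<close>)
  then show "r \<le> isolation_number k ?G" by simp
qed

theorem theorem1p3:
  shows "(\<forall>G :: ('a,'b) pre_digraph.
            graph G \<and> Digraph_Component.connected G \<and> card (verts G) \<ge> 3 \<and> \<not> star G \<longrightarrow>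
            (\<forall>k\<ge>1. real (isolation_number k G)
                      \<le> (real (card (verts G)) - real (leaf_order G)) / 2))
       \<and> (\<forall>k r n :: nat. k \<ge> 1 \<and> r \<ge> 1 \<and> n \<ge> max ((k + 2) * r) 4 \<longrightarrow>
            (\<exists>G :: (nat, nat \<times> nat) pre_digraph.
               graph G \<and> card (verts G) = n \<and>
               real (isolation_number k G) = (real n - real (leaf_order G)) / 2 \<and>
               (real n - real (leaf_order G)) / 2 = real r))"
proof (intro conjI allI impI)
  fix G :: "('a,'b) pre_digraph" and k :: nat
  assume G: "graph G \<and> Digraph_Component.connected G \<and> card (verts G) \<ge> 3 \<and> \<not> star G" and "1 \<le> k"
  then interpret graph G by blast
  have "2 * isolation_number k G + leaf_order G \<le> card (verts G)"
    using isolation_number_upper G \<open>1 \<le> k\<close> by blast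
  then have "real (2 * isolation_number k G + leaf_order G) \<le> real (card (verts G))"
    by (rule of_nat_mono)
  then show "real (isolation_number k G) \<le> (real (card (verts G)) - real (leaf_order G)) / 2"
    by simp
next
  fix k r n :: nat
  assume "k \<ge> 1 \<and> r \<ge> 1 \<and> n \<ge> max ((k + 2) * r) 4"
  then have k: "k \<ge> 1" and r: "r \<ge> 1" and n: "(k + 2) * r \<le> n" "4 \<le> n" by auto
  have "3 * r \<le> (k + 2) * r" using k by (intro mult_right_mono) auto
  then have n3: "3 * r \<le> n" using n by linarith
  let ?G = "with_proj (leafy_clique r n)"
  have "leaf_order ?G = n - 2 * r"
    using leaves_leafy_clique[OF r n3 n(2)] by (simp add: leaf_order_def)
  then have "(real n - real (leaf_order ?G)) / 2 = real r" using n3 by (simp add: of_nat_diff)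
  then show "\<exists>G :: (nat, nat \<times> nat) pre_digraph.
               graph G \<and> card (verts G) = n \<and>
               real (isolation_number k G) = (real n - real (leaf_order G)) / 2 \<and>
               (real n - real (leaf_order G)) / 2 = real r"
    using graph_leafy_clique[OF r] isolation_number_leafy_clique[OF k r n]
    by (intro exI[of _ ?G]) (simp add: leafy_clique_simps(1))
qed

end
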